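(* Let $G$ be a finite (weighted di)graph with adjacency matrix $\mathsf{A}$. Let $H$ be an induced subgraph of $G$ and let $\mathcal{P}_H$ be the set of primes (simple cycles) on $H$. Let $\mathcal{H}$ be the set of hikes on $G$ and let $\rho:\mathcal{H}\to\mathbb{R}$ be a rank function on hikes such that $|\mathcal{H}_\varrho|=\lambda^{\varrho}f(\varrho)$, with $\lambda$ a real constant and $f$ a bounded function such that $\lim_{\varrho\to\infty}f(\varrho)$ exists. Then the number (weight) $S(\mathcal{H}_\varrho,\mathcal{P}_H)$ of hikes $h$ of rank $\rho(h)=\varrho$ which are not multiples of primes on $H$ is asymptotically given by $$\frac{S(\mathcal{H}_\varrho,\mathcal{P}_H)}{|\mathcal{H}_\varrho|}\sim\sum_{d\in\mathcal{P}_H^{s.a.}}\mu(d)\,\lambda^{-\rho(d)},\qquad\text{as }\varrho\to\infty.$$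
   Context: A simple cycle (prime) is a closed walk visiting no vertex twice, up to choice of starting point, orientations being distinguished. Hikes are the elements of the trace monoid $\mathcal{H}$ generated by the simple cycles of $G$, where two simple cycles commute if and only if they are vertex-disjoint; the empty hike is $1$. A hike $h$ is a (left-)multiple of a hike $d$, equivalently $d$ right-divides $h$, if $h=h'd$ for some hike $h'$; "not multiples of primes on $H$" means not right-divisible by any prime in $\mathcal{P}_H$. A rank function is a function $\rho:\mathcal{H}\to\mathbb{R}$ that is totally additive, $\rho(hh')=\rho(h)+\rho(h')$, and respects the divisibility order ($h$ divides $h'$ implies $\rho(h)\le\rho(h')$). $\mathcal{H}_\varrho=\{h\in\mathcal{H}:\rho(h)=\varrho\}$ and $|\mathcal{H}_\varrho|$ is its cardinality; if the graph is weighted, this is understood to mean the total weight carried by the hikes of rank $\varrho$. A self-avoiding hike is a product of pairwise vertex-disjoint simple cycles (the empty hike $1$ included); $\mathcal{P}_H^{s.a.}$ is the set of all self-avoiding hikes that can be built from cycles of $\mathcal{P}_H$. The Möbius function on hikes is $\mu(h)=(-1)^{\Omega(h)}$ if $h$ is self-avoiding with $\Omega(h)$ prime factors, and $\mu(h)=0$ otherwise.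
   Formalization: The limit of f is assumed nonzero; ϱ→∞ runs through the group generated by the ranks; λ≠0, and λ>0 unless all ranks are integers; for weighted graphs each term of the sum also carries the weight of d; if the sum is 0, ∼ means convergence to 0. *)

theory Defs
  imports "HOL-Analysis.Analysis" "HOL-Library.Landau_Symbols"
begin

section \<open>Simple cycles\<close>

text \<open>
  A simple cycle is a nonempty list of distinct vertices up to rotation; the edge from the last
  vertex back to the first is implicit. Singletons are loops, lists of length two are
  back-and-forth moves along a pair of opposite arcs, and a list and its reversal are in general
  different cycles.
\<close>

definition rot_equiv :: "'v list \<Rightarrow> 'v list \<Rightarrow> bool" where
  "rot_equiv xs ys \<longleftrightarrow> xs \<noteq> [] \<and> distinct xs \<and> (\<exists>n. ys = rotate n xs)"

lemma rot_equiv_sym: "rot_equiv xs ys \<Longrightarrow> rot_equiv ys xs"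
proof -
  assume *: "rot_equiv xs ys"
  then obtain n where n: "ys = rotate n xs" and xs: "xs \<noteq> []" "distinct xs"
    by (auto simp: rot_equiv_def)
  define m where "m = length xs - n mod length xs"
  have "rotate m ys = rotate (m + n mod length xs) xs"
    unfolding n by (metis rotate_conv_mod rotate_rotate)
  also have "\<dots> = xs"
    using xs by (simp add: m_def less_imp_le rotate_id)
  finally show "rot_equiv ys xs"
    using n xs by (metis distinct_rotate rot_equiv_def rotate_is_Nil_conv)
qed

lemma rot_equiv_trans: "rot_equiv xs ys \<Longrightarrow> rot_equiv ys zs \<Longrightarrow> rot_equiv xs zs"
  by (auto simp: rot_equiv_def rotate_rotate)

quotient_type 'v cycle = "'v list" / partial: rot_equiv
proof (rule part_equivpI)
  show "\<exists>xs :: 'v list. rot_equiv xs xs"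
    by (rule exI[of _ "[undefined]"]) (auto simp: rot_equiv_def)
  show "symp (rot_equiv :: 'v list \<Rightarrow> _)"
    by (auto intro: sympI rot_equiv_sym)
  show "transp (rot_equiv :: 'v list \<Rightarrow> _)"
    by (auto intro: transpI rot_equiv_trans)
qed

lift_definition cycle_verts :: "'v cycle \<Rightarrow> 'v set" is set
  by (auto simp: rot_equiv_def)

lift_definition cycle_arcs :: "'v cycle \<Rightarrow> ('v \<times> 'v) set" is "\<lambda>xs. set (zip xs (rotate1 xs))"
proof -
  fix xs ys :: "'v list"
  assume "rot_equiv xs ys"
  then obtain n where n: "ys = rotate n xs"
    by (auto simp: rot_equiv_def)
  have "zip (rotate1 zs) (rotate1 ws) = rotate1 (zip zs ws)" if "length zs = length ws"
    for zs ws :: "'v list"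
    using that by (cases zs; cases ws) auto
  then have step: "set (zip (rotate1 zs) (rotate1 (rotate1 zs))) = set (zip zs (rotate1 zs))"
    for zs :: "'v list"
    by (metis length_rotate1 set_rotate1)
  have "set (zip (rotate n xs) (rotate1 (rotate n xs))) = set (zip xs (rotate1 xs))"
    by (induction n) (simp_all add: step)
  then show "set (zip xs (rotate1 xs)) = set (zip ys (rotate1 ys))"
    by (simp add: n)
qed

definition disjoint_cycles :: "'v cycle \<Rightarrow> 'v cycle \<Rightarrow> bool" where
  "disjoint_cycles c d \<longleftrightarrow> cycle_verts c \<inter> cycle_verts d = {}"


section \<open>The trace monoid of hikes\<close>

definition swap_step :: "'v cycle list \<Rightarrow> 'v cycle list \<Rightarrow> bool" where
  "swap_step cs ds \<longleftrightarrow>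
     (\<exists>us vs c d. disjoint_cycles c d \<and> cs = us @ [c, d] @ vs \<and> ds = us @ [d, c] @ vs)"

text \<open>
  The trace monoid is formed over all simple cycles on the vertex type. The hikes on a given
  graph are the submonoid generated by its simple cycles; since a swap does not change the cycles
  that occur in a word, this submonoid is the trace monoid over those cycles.
\<close>

quotient_type 'v hike = "'v cycle list" / "equivclp swap_step"
  by (rule equivp_evquivclp)

lemma equivclp_swap_step_append:
  assumes "equivclp swap_step a b" "equivclp swap_step c d"
  shows "equivclp swap_step (a @ c) (b @ d)"
proof -
  have l: "swap_step x y \<Longrightarrow> swap_step (x @ z) (y @ z)" for x y z :: "'a cycle list"
    unfolding swap_step_def by (metis append.assoc)
  have r: "swap_step x y \<Longrightarrow> swap_step (z @ x) (z @ y)" for x y z :: "'a cycle list"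
    unfolding swap_step_def by (metis append.assoc)
  have "equivclp swap_step (a @ c) (b @ c)"
    using assms(1)
    by (induction rule: equivclp_induct) (auto dest: l intro: equivclp_into_equivclp)
  moreover have "equivclp swap_step (b @ c) (b @ d)"
    using assms(2)
    by (induction rule: equivclp_induct) (auto dest: r intro: equivclp_into_equivclp)
  ultimately show ?thesis
    by (rule equivclp_trans)
qed

instantiation hike :: (type) monoid_mult
begin

lift_definition one_hike :: "'a hike" is "[]" .

lift_definition times_hike :: "'a hike \<Rightarrow> 'a hike \<Rightarrow> 'a hike" is "(@)"
  by (rule equivclp_swap_step_append)

instance
  by standard (transfer, simp add: equivclp_refl)+

end

definition prime_hike :: "'v cycle \<Rightarrow> 'v hike" where
  "prime_hike c = abs_hike [c]"

lemma equivclp_swap_step_prod_list: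
  fixes g :: "'v cycle \<Rightarrow> 'b :: comm_monoid_mult"
  assumes "equivclp swap_step cs ds"
  shows "prod_list (map g cs) = prod_list (map g ds)"
  using assms
  by (induction rule: equivclp_induct) (auto simp: swap_step_def mult_ac)

lift_definition Omega :: "'v hike \<Rightarrow> nat" is length
proof -
  fix cs ds :: "'v cycle list"
  assume "equivclp swap_step cs ds"
  then show "length cs = length ds"
    by (induction rule: equivclp_induct) (auto simp: swap_step_def)
qed

text \<open>The class relation \<^term>\<open>(dvd)\<close> would be divisibility from the left.\<close>

definition right_dvd :: "'v hike \<Rightarrow> 'v hike \<Rightarrow> bool" where
  "right_dvd d h \<longleftrightarrow> (\<exists>h'. h = h' * d)"

definition self_avoiding :: "'v hike \<Rightarrow> bool" where
  "self_avoiding h \<longleftrightarrow>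
     (\<exists>cs. sorted_wrt disjoint_cycles cs \<and> h = prod_list (map prime_hike cs))"

definition mobius :: "'v hike \<Rightarrow> real" where
  "mobius h = (if self_avoiding h then (-1) ^ Omega h else 0)"


section \<open>Graphs\<close>

text \<open>A graph is given by its set of arcs. Matrix entries equal to zero mean that there is no arc.\<close>

definition arcs :: "real ^ 'v ^ 'v \<Rightarrow> ('v \<times> 'v) set" where
  "arcs A = {(i, j). A $ i $ j \<noteq> 0}"

definition induced_arcs :: "('v \<times> 'v) set \<Rightarrow> 'v set \<Rightarrow> ('v \<times> 'v) set" where
  "induced_arcs E U = E \<inter> (U \<times> U)"

definition primes :: "('v \<times> 'v) set \<Rightarrow> 'v cycle set" where
  "primes E = {c. cycle_arcs c \<subseteq> E}"

definition hikes :: "('v \<times> 'v) set \<Rightarrow> 'v hike set" where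
  "hikes E = {prod_list (map prime_hike cs) | cs. set cs \<subseteq> primes E}"

definition self_avoiding_hikes :: "('v \<times> 'v) set \<Rightarrow> 'v hike set" where
  "self_avoiding_hikes E = {h \<in> hikes E. self_avoiding h}"

definition cycle_weight :: "real ^ 'v ^ 'v \<Rightarrow> 'v cycle \<Rightarrow> real" where
  "cycle_weight A c = (\<Prod>(i, j)\<in>cycle_arcs c. A $ i $ j)"

lift_definition hike_weight :: "real ^ 'v ^ 'v \<Rightarrow> 'v hike \<Rightarrow> real"
  is "\<lambda>A cs. prod_list (map (cycle_weight A) cs)"
  by (rule equivclp_swap_step_prod_list)

definition total_weight :: "real ^ 'v ^ 'v \<Rightarrow> 'v hike set \<Rightarrow> real" where
  "total_weight A X = infsum (hike_weight A) X"

definition unweighted :: "real ^ 'v ^ 'v \<Rightarrow> bool" where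
  "unweighted A \<longleftrightarrow> (\<forall>i j. A $ i $ j \<in> {0, 1})"


section \<open>Rank functions\<close>

definition rank_function :: "('v \<times> 'v) set \<Rightarrow> ('v hike \<Rightarrow> real) \<Rightarrow> bool" where
  "rank_function E \<rho> \<longleftrightarrow>
     (\<forall>h\<in>hikes E. \<forall>h'\<in>hikes E. \<rho> (h * h') = \<rho> h + \<rho> h') \<and>
     (\<forall>h\<in>hikes E. \<forall>h'\<in>hikes E. right_dvd h h' \<longrightarrow> \<rho> h \<le> \<rho> h')"

definition hikes_of_rank :: "('v \<times> 'v) set \<Rightarrow> ('v hike \<Rightarrow> real) \<Rightarrow> real \<Rightarrow> 'v hike set" where
  "hikes_of_rank E \<rho> r = {h \<in> hikes E. \<rho> h = r}"

definition sifted_hikes ::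
  "('v \<times> 'v) set \<Rightarrow> ('v hike \<Rightarrow> real) \<Rightarrow> 'v cycle set \<Rightarrow> real \<Rightarrow> 'v hike set" where
  "sifted_hikes E \<rho> P r = {h \<in> hikes_of_rank E \<rho> r. \<forall>p\<in>P. \<not> right_dvd (prime_hike p) h}"

text \<open>
  The additive group generated by the ranks. There are only countably many ranks, so the limit
  of the normalised count over all real numbers could only be zero; ranks tend to infinity inside
  this group (for the length function of an aperiodic graph with cycles: inside the integers).
  It is not enough to use the set of ranks itself, which need not be closed under subtracting the
  rank of a divisor: for two disjoint loops of ranks 1 and \<open>sqrt 2\<close> there is one hike of each rank,
  but the proportion of those that are not multiples of the first loop does not converge.
\<close>

definition rank_group :: "('v \<times> 'v) set \<Rightarrow> ('v hike \<Rightarrow> real) \<Rightarrow> real set" where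
  "rank_group E \<rho> = {\<rho> h - \<rho> h' | h h'. h \<in> hikes E \<and> h' \<in> hikes E}"

definition rank_at_top :: "('v \<times> 'v) set \<Rightarrow> ('v hike \<Rightarrow> real) \<Rightarrow> real filter" where
  "rank_at_top E \<rho> = inf at_top (principal (rank_group E \<rho>))"

text \<open>Real powers of a possibly negative base; for positive bases this is \<^term>\<open>(powr)\<close>.\<close>

definition real_power :: "real \<Rightarrow> real \<Rightarrow> real" where
  "real_power a x = (if x \<in> \<int> then a powi \<lfloor>x\<rfloor> else a powr x)"

definition real_power_defined :: "real \<Rightarrow> real set \<Rightarrow> bool" where
  "real_power_defined a X \<longleftrightarrow> a > 0 \<or> a \<noteq> 0 \<and> X \<subseteq> \<int>"

text \<open>
  Asymptotic equivalence to a constant. Landau equivalence to zero means being eventually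
  zero, which is not what is meant, so for the constant zero only convergence is required.
\<close>

definition asymp_const :: "(real \<Rightarrow> real) \<Rightarrow> real \<Rightarrow> real filter \<Rightarrow> bool" where
  "asymp_const g c F \<longleftrightarrow> (g \<longlongrightarrow> c) F \<and> (c \<noteq> 0 \<longrightarrow> g \<sim>[F] (\<lambda>_. c))"

end

(* Let R(h) be the set of primes on H that right-divide the hike h. The trace monoid is
   right-cancellative, the elements of R(h) are pairwise vertex-disjoint, and the self-avoiding
   right divisors of h built from primes on H are exactly the products of subsets of R(h). So the
   sum of their Moebius values is 1 if R(h) is empty and 0 otherwise, and cancelling d in the
   hikes of rank r that are multiples of d gives the exact sieve
   S(r) = sum over d of mu(d) * weight(d) * W(r - rho(d)), with W(r) the weight of all hikes of
   rank r. This is a finite sum, so one may divide by W(r) and pass to the limit termwise. *)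

theory Submission
  imports Defs
begin

section \<open>Cancellation in the trace monoid\<close>

lemma disjoint_cycles_sym: "disjoint_cycles c d \<Longrightarrow> disjoint_cycles d c"
  by (auto simp: disjoint_cycles_def)

lemma not_disjoint_cycles_self: "\<not> disjoint_cycles c c"
  unfolding disjoint_cycles_def by (transfer, auto simp: rot_equiv_def)

lemma prod_list_prime_hike: "prod_list (map prime_hike cs) = abs_hike cs"
  by (induction cs) (auto simp: one_hike.abs_eq prime_hike_def times_hike.abs_eq)

text \<open>Primes are split off on the right, the side on which \<open>cancel\<close> and
  \<open>right_dvd\<close> act.\<close>

lemma hike_induct [case_names one times]:
  assumes "P 1" and "\<And>h c. P h \<Longrightarrow> P (h * prime_hike c)"
  shows "P h"
proof -
  obtain cs where "h = abs_hike cs"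
    by (metis Quotient_hike Quotient_abs_rep)
  moreover have "P (abs_hike cs)"
  proof (induction cs rule: rev_induct)
    case (snoc c cs)
    then show ?case
      using assms(2)[of "abs_hike cs" c] by (simp add: prime_hike_def times_hike.abs_eq)
  qed (use assms(1) in \<open>simp add: one_hike.abs_eq\<close>)
  ultimately show ?thesis by simp
qed

lemma prime_hike_commute:
  assumes "disjoint_cycles c d"
  shows "prime_hike c * prime_hike d = prime_hike d * prime_hike c"
proof -
  have "swap_step [c, d] [d, c]"
    unfolding swap_step_def using assms by (intro exI[of _ "[]"]) auto
  then show ?thesis
    by (auto simp: prime_hike_def times_hike.abs_eq hike.abs_eq_iff)
qed

text \<open>Applied to reversed words, this cancels a prime on the right.\<close>

fun remove_commuting :: "'v cycle \<Rightarrow> 'v cycle list \<Rightarrow> 'v cycle list option" where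
  "remove_commuting c [] = None"
| "remove_commuting c (x # xs) =
     (if x = c then Some xs
      else if disjoint_cycles c x then map_option ((#) x) (remove_commuting c xs)
      else None)"

lemma swap_step_Cons: "swap_step xs ys \<Longrightarrow> swap_step (x # xs) (x # ys)"
  unfolding swap_step_def by (metis append_Cons)

lemma swap_step_rev: 
  assumes "swap_step xs ys" shows "swap_step (rev xs) (rev ys)"
proof -
  from assms obtain us vs c d where *: "disjoint_cycles c d"
    "xs = us @ [c, d] @ vs" "ys = us @ [d, c] @ vs"
    by (auto simp: swap_step_def)
  then have "rev xs = rev vs @ [d, c] @ rev us" "rev ys = rev vs @ [c, d] @ rev us" by auto
  with *(1) show ?thesis unfolding swap_step_def using disjoint_cycles_sym by blast
qed

lemma equivclp_swap_step_rev:
  "equivclp swap_step xs ys \<Longrightarrow> equivclp swap_step (rev xs) (rev ys)"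
  by (induction rule: equivclp_induct) (auto dest: swap_step_rev intro: equivclp_into_equivclp)

text \<open>A swap that involves the removed letter leaves equal results; any other swap survives as
  a swap of the results, or both removals fail. The relator \<open>rel_option\<close> also records
  that failure agrees on both sides.\<close>

lemma remove_commuting_swap_step:
  assumes "swap_step xs ys"
  shows "rel_option (equivclp swap_step) (remove_commuting e xs) (remove_commuting e ys)"
proof -
  from assms obtain us vs c d where *: "disjoint_cycles c d"
    "xs = us @ [c, d] @ vs" "ys = us @ [d, c] @ vs"
    by (auto simp: swap_step_def)
  have "rel_option (equivclp swap_step)
      (remove_commuting e (us @ [c, d] @ vs)) (remove_commuting e (us @ [d, c] @ vs))"
  proof (induction us)
    case Nil
    have "swap_step (c # d # l) (d # c # l)" for l
      unfolding swap_step_def using *(1) by (intro exI[of _ "[]"] exI[of _ l]) auto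
    then show ?case
      using *(1) by (cases "remove_commuting e vs")
        (auto dest: disjoint_cycles_sym simp: not_disjoint_cycles_self)
  next
    case (Cons u us)
    \<comment> \<open>If \<open>u = e\<close>, the removal stops at once and returns the untouched
      tails, which differ by this very swap. Otherwise \<open>u\<close> is put back in front of both
      results.\<close>
    have "swap_step (us @ [c, d] @ vs) (us @ [d, c] @ vs)"
      unfolding swap_step_def using *(1) by blast
    moreover have "equivclp swap_step (x # a) (x # b)" if "equivclp swap_step a b" for x a b
      using that
      by (induction rule: equivclp_induct) (auto dest: swap_step_Cons intro: equivclp_into_equivclp)
    ultimately show ?case
      using Cons by (auto simp: option.rel_map elim!: option.rel_mono_strong)
  qed
  with * show ?thesis by simp
qed

lemma remove_commuting_equivclp:
  assumes "equivclp swap_step xs ys"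
  shows "rel_option (equivclp swap_step) (remove_commuting e xs) (remove_commuting e ys)"
  using assms
proof (induction rule: equivclp_induct)
  case base
  then show ?case by (simp add: option.rel_refl)
next
  case (step y z)
  have "rel_option (equivclp swap_step) (remove_commuting e y) (remove_commuting e z)"
    using step(2)
  proof
    assume "swap_step z y"
    from remove_commuting_swap_step[OF this, of e] show ?thesis
      by (cases "remove_commuting e y"; cases "remove_commuting e z") (auto intro: equivclp_sym)
  qed (rule remove_commuting_swap_step)
  with step(3) show ?case
    by (cases "remove_commuting e y"; cases "remove_commuting e z";
        cases "remove_commuting e xs") (auto intro: equivclp_trans)
qed

lift_definition cancel :: "'v cycle \<Rightarrow> 'v hike \<Rightarrow> 'v hike option"
  is "\<lambda>c cs. map_option rev (remove_commuting c (rev cs))"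
  by (drule equivclp_swap_step_rev, drule remove_commuting_equivclp)
    (auto simp: option.rel_map elim!: option.rel_mono_strong intro: equivclp_swap_step_rev)

lemma cancel_one: "cancel c 1 = None"
  by (simp add: one_hike.abs_eq cancel.abs_eq)

text \<open>Right cancellation and the disjointness of right-dividing primes are both read off from
  this recursion on the last prime: another prime can be reached only by commuting past it.\<close>

lemma cancel_times_prime:
  "cancel c (h * prime_hike d) =
     (if d = c then Some h
      else if disjoint_cycles c d then map_option (\<lambda>k. k * prime_hike d) (cancel c h)
      else None)"
proof -
  obtain cs where h: "h = abs_hike cs"
    by (metis Quotient_hike Quotient_abs_rep)
  show ?thesis
    unfolding h prime_hike_def
    by (auto simp: cancel.abs_eq times_hike.abs_eq option.map_comp o_def)
qed

lemma cancel_SomeD: "cancel c h = Some k \<Longrightarrow> h = k * prime_hike c"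
proof (induction h arbitrary: k rule: hike_induct)
  case (times h d)
  show ?case
  proof (cases "d = c")
    case False
    with times.prems obtain l where "disjoint_cycles c d" "cancel c h = Some l" "k = l * prime_hike d"
      by (auto simp: cancel_times_prime split: if_splits)
    with times.IH[of l] prime_hike_commute[of c d] show ?thesis
      by (metis mult.assoc)
  qed (use times.prems in \<open>simp add: cancel_times_prime\<close>)
qed (simp add: cancel_one)

lemma right_dvd_prime_iff: "right_dvd (prime_hike c) h \<longleftrightarrow> cancel c h \<noteq> None"
  by (auto simp: right_dvd_def cancel_times_prime dest: cancel_SomeD)

text \<open>The function \<open>cancel c\<close> undoes multiplication by
  \<open>prime_hike c\<close> on the right, so the primes of \<open>d\<close> can be stripped one at
  a time.\<close>

lemma hike_right_cancel: 
  fixes d h k :: "'v hike"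
  assumes "h * d = k * d" shows "h = k"
  using assms
proof (induction d arbitrary: h k rule: hike_induct)
  case (times d c)
  then have "cancel c (h * d * prime_hike c) = cancel c (k * d * prime_hike c)"
    by (simp add: mult.assoc)
  then show ?case by (auto simp: cancel_times_prime intro: times.IH)
qed simp

section \<open>Self-avoiding divisors\<close>

text \<open>Write \<open>h\<close> with \<open>d\<close> as its last prime; to be cancelled,
  \<open>c\<close> must commute past it.\<close>

lemma right_dvd_primes_disjoint:
  assumes "right_dvd (prime_hike c) h" "right_dvd (prime_hike d) h" "c \<noteq> d"
  shows "disjoint_cycles c d"
proof -
  from assms(2) obtain k where "h = k * prime_hike d"
    by (auto simp: right_dvd_def)
  with assms(1,3) show ?thesis
    by (auto simp: right_dvd_prime_iff cancel_times_prime split: if_splits)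
qed

text \<open>No cycle in \<open>ds\<close> can supply the divisor \<open>c\<close>, since
  \<open>c\<close> is not disjoint from itself; hence \<open>c\<close> already comes from
  \<open>h\<close>.\<close>

lemma right_dvd_prime_times:
  assumes "right_dvd (prime_hike c) (h * abs_hike ds)" "\<forall>d\<in>set ds. disjoint_cycles c d"
  shows "right_dvd (prime_hike c) h"
  using assms
proof (induction ds rule: rev_induct)
  case Nil
  then show ?case by (simp flip: one_hike.abs_eq)
next
  case (snoc d ds)
  have "abs_hike (ds @ [d]) = abs_hike ds * prime_hike d"
    by (simp add: prime_hike_def times_hike.abs_eq)
  then have "cancel c (h * abs_hike ds * prime_hike d) \<noteq> None"
    using snoc.prems by (simp add: right_dvd_prime_iff mult.assoc)
  then show ?case
    using snoc by (auto simp: cancel_times_prime right_dvd_prime_iff not_disjoint_cycles_self split: if_splits)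
qed

lemma abs_hike_Cons: "abs_hike (c # cs) = prime_hike c * abs_hike cs"
  by (simp add: prime_hike_def times_hike.abs_eq)

lemma prime_hike_commute_list:
  "\<forall>d\<in>set ds. disjoint_cycles c d \<Longrightarrow> prime_hike c * abs_hike ds = abs_hike ds * prime_hike c"
proof (induction ds)
  case Nil
  then show ?case by (simp flip: one_hike.abs_eq)
next
  case (Cons d ds)
  then show ?case
    using prime_hike_commute[of c d] by (simp add: abs_hike_Cons) (metis mult.assoc)
qed

text \<open>A self-avoiding hike is the join of its primes in the divisibility order. Each factor
  can be moved to the right end. Conversely, once \<open>abs_hike cs\<close> is split off, the
  remaining prime is disjoint from it and must divide the cofactor.\<close>

lemma right_dvd_disjoint_iff:
  assumes "sorted_wrt disjoint_cycles cs"
  shows "right_dvd (abs_hike cs) h \<longleftrightarrow> (\<forall>c\<in>set cs. right_dvd (prime_hike c) h)"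
  using assms
proof (induction cs)
  case Nil
  then show ?case by (auto simp: right_dvd_def simp flip: one_hike.abs_eq)
next
  case (Cons c cs)
  show ?case
  proof
    assume "right_dvd (abs_hike (c # cs)) h"
    then obtain k where k: "h = k * (prime_hike c * abs_hike cs)"
      by (auto simp: right_dvd_def abs_hike_Cons)
    with Cons.prems have "h = k * abs_hike cs * prime_hike c"
      by (simp add: prime_hike_commute_list mult.assoc)
    moreover have "right_dvd (abs_hike cs) h"
      unfolding right_dvd_def k by (metis mult.assoc)
    ultimately show "\<forall>c\<in>set (c # cs). right_dvd (prime_hike c) h"
      using Cons by (auto simp: right_dvd_def[of "prime_hike c"])
  next
    assume *: "\<forall>c\<in>set (c # cs). right_dvd (prime_hike c) h"
    with Cons obtain k where k: "h = k * abs_hike cs"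
      by (auto simp: right_dvd_def[of "abs_hike cs"])
    with * Cons.prems have "right_dvd (prime_hike c) k"
      by (intro right_dvd_prime_times[of c k cs]) auto
    with k show "right_dvd (abs_hike (c # cs)) h"
      by (auto simp: right_dvd_def abs_hike_Cons mult.assoc)
  qed
qed

section \<open>Cycles occurring in a hike, and self-avoiding hikes as sets of cycles\<close>

definition hike_cycles :: "'v hike \<Rightarrow> 'v cycle set" where
  "hike_cycles h = set (rep_hike h)"

lemma equivclp_swap_step_set: "equivclp swap_step cs ds \<Longrightarrow> set cs = set ds"
proof (induction rule: equivclp_induct)
  case (step ds es)
  have "set ds = set es"
    using step.hyps(2) by (elim disjE) (auto simp: swap_step_def)
  with step.IH show ?case by simp
qed simp

text \<open>The representative chosen by \<open>rep_hike\<close> does not matter, because swaps only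
  permute the letters of a word.\<close>

lemma hike_cycles_abs_hike: "hike_cycles (abs_hike cs) = set cs"
proof -
  have "equivclp swap_step cs (rep_hike (abs_hike cs))"
    by (metis Quotient3_hike hike.abs_eq_iff Quotient3_abs_rep)
  then show ?thesis
    by (simp add: hike_cycles_def equivclp_swap_step_set)
qed

lemma hike_cycles_times: "hike_cycles (h * k) = hike_cycles h \<union> hike_cycles k"
proof -
  obtain cs ds where "h = abs_hike cs" "k = abs_hike ds"
    by (metis Quotient3_hike Quotient3_abs_rep)
  then show ?thesis
    by (simp add: times_hike.abs_eq hike_cycles_abs_hike)
qed

lemma Omega_times: "Omega (h * k) = Omega h + Omega k"
  by transfer simp

lemma Omega_eq_0_iff: "Omega h = 0 \<longleftrightarrow> h = 1"
  by (metis Omega.abs_eq Quotient3_abs_rep Quotient3_hike length_0_conv one_hike.abs_eq)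

lemma hike_weight_times: "hike_weight A (h * k) = hike_weight A h * hike_weight A k"
  by transfer simp

text \<open>Replaces generation by a condition on the occurring cycles, which visibly passes to
  factors.\<close>

lemma hikes_conv: "hikes E = {h. hike_cycles h \<subseteq> primes E}"
proof -
  have "h \<in> hikes E" if "hike_cycles h \<subseteq> primes E" for h
  proof -
    obtain cs where "h = abs_hike cs"
      by (metis Quotient_hike Quotient_abs_rep)
    with that show ?thesis
      by (auto simp: hikes_def prod_list_prime_hike hike_cycles_abs_hike)
  qed
  then show ?thesis
    by (auto simp: hikes_def prod_list_prime_hike hike_cycles_abs_hike)
qed

lemma self_avoiding_conv:
  "self_avoiding h \<longleftrightarrow> (\<exists>cs. sorted_wrt disjoint_cycles cs \<and> h = abs_hike cs)"
  by (simp add: self_avoiding_def prod_list_prime_hike)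

lemma sorted_wrt_disjoint_distinct: "sorted_wrt disjoint_cycles cs \<Longrightarrow> distinct cs"
  by (induction cs) (auto simp: not_disjoint_cycles_self)

text \<open>With the same cycles, \<open>d\<close> divides \<open>e\<close> since each of its primes
  does. Both have equally many factors, so the cofactor has length 0 and is 1.\<close>

lemma inj_on_hike_cycles: "inj_on hike_cycles (Collect self_avoiding)"
proof (rule inj_onI)
  fix d e :: "'a hike"
  assume "d \<in> Collect self_avoiding" "e \<in> Collect self_avoiding" and eq: "hike_cycles d = hike_cycles e"
  then obtain cs ds where cs: "sorted_wrt disjoint_cycles cs" "d = abs_hike cs"
    and ds: "sorted_wrt disjoint_cycles ds" "e = abs_hike ds"
    by (auto simp: self_avoiding_conv)
  have set: "set cs = set ds"
    using eq by (simp add: cs ds hike_cycles_abs_hike)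
  have "right_dvd e e"
    unfolding right_dvd_def by (metis mult_1)
  then have "right_dvd d e"
    using right_dvd_disjoint_iff[OF cs(1)] right_dvd_disjoint_iff[OF ds(1)] cs ds set by auto
  then obtain k where k: "e = k * d"
    by (auto simp: right_dvd_def)
  have "Omega d = Omega e"
    using set sorted_wrt_disjoint_distinct cs ds by (metis Omega.abs_eq distinct_card)
  with k show "d = e"
    by (simp add: Omega_times Omega_eq_0_iff)
qed

lemma mobius_self_avoiding:
  assumes "self_avoiding d"
  shows "mobius d = (-1) ^ card (hike_cycles d)"
  using assms
  by (auto simp: mobius_def self_avoiding_conv Omega.abs_eq hike_cycles_abs_hike
      sorted_wrt_disjoint_distinct distinct_card)

section \<open>Finiteness, and the Moebius sum over right divisors\<close>

lemma finite_primes: "finite (primes (E :: ('v::finite \<times> 'v) set))"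
proof -
  have "finite {xs :: 'v list. distinct xs}"
    using finite_subset_distinct[of "UNIV :: 'v set"] by simp
  moreover have "primes E \<subseteq> abs_cycle ` {xs. distinct xs}"
  proof
    fix c assume "c \<in> primes E"
    \<comment> \<open>The quotient is partial: representatives lie in the domain of
      \<open>rot_equiv\<close>, hence are lists of distinct vertices.\<close>
    have "rot_equiv (rep_cycle c) (rep_cycle c)" "abs_cycle (rep_cycle c) = c"
      using Quotient_cycle by (auto intro: Quotient_rep_reflp Quotient_abs_rep)
    then show "c \<in> abs_cycle ` {xs. distinct xs}"
      by (intro rev_image_eqI[of "rep_cycle c"]) (auto simp: rot_equiv_def)
  qed
  ultimately show ?thesis
    by (rule finite_surj)
qed

lemma finite_self_avoiding_hikes:
  "finite (self_avoiding_hikes (E :: ('v::finite \<times> 'v) set))"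
proof (rule finite_imageD)
  show "finite (hike_cycles ` self_avoiding_hikes E)"
    by (rule finite_subset[of _ "Pow (primes E)"])
      (auto simp: self_avoiding_hikes_def hikes_conv finite_primes)
  show "inj_on hike_cycles (self_avoiding_hikes E)"
    by (rule inj_on_subset[OF inj_on_hike_cycles]) (auto simp: self_avoiding_hikes_def)
qed

lemma bij_betw_self_avoiding_divisors:
  "bij_betw hike_cycles {d \<in> self_avoiding_hikes E. right_dvd d h}
     (Pow {p \<in> primes (E :: ('v::finite \<times> 'v) set). right_dvd (prime_hike p) h})"
    (is "bij_betw _ ?D (Pow ?R)")
proof (rule bij_betw_imageI)
  show "inj_on hike_cycles ?D"
    by (rule inj_on_subset[OF inj_on_hike_cycles]) (auto simp: self_avoiding_hikes_def)
  show "hike_cycles ` ?D = Pow ?R"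
  proof (intro equalityI subsetI)
    fix C assume "C \<in> hike_cycles ` ?D"
    then show "C \<in> Pow ?R"
      by (auto simp: self_avoiding_hikes_def self_avoiding_conv right_dvd_disjoint_iff
          hikes_conv hike_cycles_abs_hike)
  next
    fix C assume C: "C \<in> Pow ?R"
    then have "finite C"
      using finite_primes[of E] by (auto intro: finite_subset)
    then obtain cs where cs: "set cs = C" "distinct cs"
      using finite_distinct_list by blast
    \<comment> \<open>Distinct primes that right-divide the same \<open>h\<close> are disjoint, so
      any enumeration of \<open>C\<close> without repetition will do.\<close>
    have "sorted_wrt disjoint_cycles cs"
      using cs C right_dvd_primes_disjoint[of _ h]
      by (auto simp: sorted_wrt_iff_nth_less subset_iff) (metis nth_mem nth_eq_iff_index_eq order_less_trans nat_neq_iff)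
    with cs C have "abs_hike cs \<in> ?D"
      by (auto simp: self_avoiding_hikes_def self_avoiding_conv right_dvd_disjoint_iff
          hikes_conv hike_cycles_abs_hike)
    then show "C \<in> hike_cycles ` ?D"
      by (rule rev_image_eqI) (simp add: hike_cycles_abs_hike cs)
  qed
qed

lemma sum_mobius_divisors:
  fixes E :: "('v::finite \<times> 'v) set"
  shows "(\<Sum>d | d \<in> self_avoiding_hikes E \<and> right_dvd d h. mobius d) =
     (if \<exists>p\<in>primes E. right_dvd (prime_hike p) h then 0 else 1)"
proof -
  let ?R = "{p \<in> primes E. right_dvd (prime_hike p) h}"
  have fin: "finite ?R"
    using finite_primes[of E] by (rule finite_subset[rotated]) auto
  have "(\<Sum>d | d \<in> self_avoiding_hikes E \<and> right_dvd d h. mobius d) =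
      (\<Sum>d | d \<in> self_avoiding_hikes E \<and> right_dvd d h. (-1) ^ card (hike_cycles d))"
    by (intro sum.cong) (auto simp: mobius_self_avoiding self_avoiding_hikes_def)
  also have "\<dots> = (\<Sum>C\<in>Pow ?R. (-1) ^ card C)"
    by (rule sum.reindex_bij_betw[OF bij_betw_self_avoiding_divisors])
  \<comment> \<open>The alternating sum over subsets is the expansion of this product, which is 0
    unless it is empty.\<close>
  also have "\<dots> = (\<Prod>p\<in>?R. 1 - 1)"
    by (subst prod_diff_conv_sum) (simp_all add: fin)
  also have "\<dots> = (if \<exists>p\<in>primes E. right_dvd (prime_hike p) h then 0 else 1)"
  proof (cases "?R = {}")
    case False
    with fin have "(\<Prod>p\<in>?R. 1 - 1 :: real) = 0"
      by (intro prod_zero) auto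
    with False show ?thesis by auto
  next
    case True
    then have "\<not> (\<exists>p\<in>primes E. right_dvd (prime_hike p) h)"
      by blast
    with True show ?thesis by (simp only: prod.empty if_False)
  qed
  finally show ?thesis .
qed


section \<open>The sieve\<close>

lemma hikes_times_iff: "h * d \<in> hikes E \<longleftrightarrow> h \<in> hikes E \<and> d \<in> hikes E"
  by (auto simp: hikes_conv hike_cycles_times)

lemma one_in_hikes: "1 \<in> hikes E"
  by (simp add: hikes_conv one_hike.abs_eq hike_cycles_abs_hike)

lemma hikes_mono: "F \<subseteq> E \<Longrightarrow> hikes F \<subseteq> hikes E"
  by (auto simp: hikes_conv primes_def)

lemma rank_times:
  "rank_function E \<rho> \<Longrightarrow> h \<in> hikes E \<Longrightarrow> k \<in> hikes E \<Longrightarrow> \<rho> (h * k) = \<rho> h + \<rho> k"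
  by (simp add: rank_function_def)

lemma rank_one: "rank_function E \<rho> \<Longrightarrow> \<rho> 1 = 0"
  using rank_times[of E \<rho> 1 1] by (simp add: one_in_hikes)

text \<open>A prime may have rank 0, so one rank may carry infinitely many hikes. Only the sum over
  divisors is finite, and this lemma exchanges it with the sum over hikes.\<close>

lemma has_sum_sum:
  fixes g :: "'a \<Rightarrow> 'b \<Rightarrow> 'c :: topological_comm_monoid_add"
  assumes "finite D" "\<And>d. d \<in> D \<Longrightarrow> (g d has_sum s d) X"
  shows "((\<lambda>x. \<Sum>d\<in>D. g d x) has_sum (\<Sum>d\<in>D. s d)) X"
  using assms by (induction D rule: finite_induct) (auto intro: has_sum_add)

text \<open>Right multiplication by \<open>d\<close> is injective by cancellation, shifts the rank
  by \<open>\<rho> d\<close> and scales every weight by \<open>hike_weight A d\<close>.\<close>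

lemma has_sum_multiples:
  assumes rank: "rank_function E \<rho>" and d: "d \<in> hikes E"
    and summable: "hike_weight A summable_on hikes_of_rank E \<rho> (r - \<rho> d)"
  shows "(hike_weight A has_sum
      hike_weight A d * total_weight A (hikes_of_rank E \<rho> (r - \<rho> d)))
      {h \<in> hikes_of_rank E \<rho> r. right_dvd d h}"
proof -
  have image: "{h \<in> hikes_of_rank E \<rho> r. right_dvd d h} =
      (\<lambda>h. h * d) ` hikes_of_rank E \<rho> (r - \<rho> d)"
    using d by (auto simp: hikes_of_rank_def right_dvd_def hikes_times_iff rank_times[OF rank]
        image_iff algebra_simps)
  have "((\<lambda>h. hike_weight A d * hike_weight A h) has_sum
      hike_weight A d * total_weight A (hikes_of_rank E \<rho> (r - \<rho> d)))
      (hikes_of_rank E \<rho> (r - \<rho> d))"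
    unfolding total_weight_def by (intro has_sum_cmult_right has_sum_infsum summable)
  moreover have "inj_on (\<lambda>h. h * d) (hikes_of_rank E \<rho> (r - \<rho> d))"
    by (auto intro: inj_onI hike_right_cancel)
  ultimately show ?thesis
    unfolding image by (simp add: has_sum_reindex o_def hike_weight_times mult.commute)
qed

text \<open>Double counting of pairs of a hike and a self-avoiding divisor: grouped by
  \<open>d\<close> they give the multiples of \<open>d\<close>, grouped by \<open>h\<close> they
  give the indicator of being sifted. The identity is exact for every real \<open>r\<close>.\<close>

lemma total_weight_sifted_hikes:
  fixes A :: "real ^ 'v::finite ^ 'v"
  assumes rank: "rank_function E \<rho>" and "F \<subseteq> E"
    and summable: "\<And>r. hike_weight A summable_on hikes_of_rank E \<rho> r"
  shows "total_weight A (sifted_hikes E \<rho> (primes F) r) =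
    (\<Sum>d\<in>self_avoiding_hikes F.
      mobius d * hike_weight A d * total_weight A (hikes_of_rank E \<rho> (r - \<rho> d)))"
proof -
  let ?w = "hike_weight A" and ?H = "hikes_of_rank E \<rho>" and ?D = "self_avoiding_hikes F"
  have D: "d \<in> hikes E" if "d \<in> ?D" for d
    using that hikes_mono[OF \<open>F \<subseteq> E\<close>] by (auto simp: self_avoiding_hikes_def)
  \<comment> \<open>The weights are extended by 0 outside the multiples of \<open>d\<close>, so that
    all summands share the index set \<open>?H r\<close>.\<close>
  have "((\<lambda>h. \<Sum>d\<in>?D. mobius d * (if right_dvd d h then ?w h else 0)) has_sum
      (\<Sum>d\<in>?D. mobius d * (?w d * total_weight A (?H (r - \<rho> d))))) (?H r)"
  proof (intro has_sum_sum finite_self_avoiding_hikes has_sum_cmult_right)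
    fix d assume "d \<in> ?D"
    from has_sum_multiples[OF rank D[OF this] summable]
    show "((\<lambda>h. if right_dvd d h then ?w h else 0) has_sum
        ?w d * total_weight A (?H (r - \<rho> d))) (?H r)"
      by (rule has_sum_cong_neutral[THEN iffD1, rotated -1]) auto
  qed
  also have "(\<lambda>h. \<Sum>d\<in>?D. mobius d * (if right_dvd d h then ?w h else 0)) =
      (\<lambda>h. (\<Sum>d | d \<in> ?D \<and> right_dvd d h. mobius d) * ?w h)"
    by (auto simp: sum_distrib_right finite_self_avoiding_hikes fun_eq_iff
        split: if_splits intro!: sum.mono_neutral_cong_right)
  also have "\<dots> = (\<lambda>h. if \<exists>p\<in>primes F. right_dvd (prime_hike p) h then 0 else ?w h)"
    by (auto simp: sum_mobius_divisors)
  finally have "(?w has_sum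
      (\<Sum>d\<in>?D. mobius d * (?w d * total_weight A (?H (r - \<rho> d))))) (sifted_hikes E \<rho> (primes F) r)"
    by (rule has_sum_cong_neutral[THEN iffD1, rotated -1]) (auto simp: sifted_hikes_def)
  then show ?thesis
    by (simp add: total_weight_def infsumI mult.assoc)
qed

section \<open>Asymptotics\<close>

lemma rank_in_rank_group:
  assumes "rank_function E \<rho>" "h \<in> hikes E"
  shows "\<rho> h \<in> rank_group E \<rho>" "- \<rho> h \<in> rank_group E \<rho>"
proof -
  have "\<rho> h = \<rho> h - \<rho> 1" "- \<rho> h = \<rho> 1 - \<rho> h"
    using rank_one[OF assms(1)] by simp_all
  with assms(2) one_in_hikes[of E] show "\<rho> h \<in> rank_group E \<rho>" "- \<rho> h \<in> rank_group E \<rho>"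
    unfolding rank_group_def by blast+
qed

text \<open>The sieve evaluates the total weight at \<open>r - \<rho> d\<close>, which need not be
  the rank of a hike. It stays in the group because \<open>d\<close> can be absorbed into the
  subtracted hike.\<close>

lemma diff_rank_in_rank_group:
  assumes rank: "rank_function E \<rho>" and "r \<in> rank_group E \<rho>" "d \<in> hikes E"
  shows "r - \<rho> d \<in> rank_group E \<rho>"
proof -
  from assms obtain h k where "r = \<rho> h - \<rho> k" "h \<in> hikes E" "k \<in> hikes E"
    by (auto simp: rank_group_def)
  with assms(3) have "r - \<rho> d = \<rho> h - \<rho> (k * d)" "k * d \<in> hikes E"
    by (auto simp: rank_times[OF rank] hikes_times_iff)
  with \<open>h \<in> hikes E\<close> show ?thesis
    unfolding rank_group_def by blast
qed

text \<open>Used to give \<open>f (r - \<rho> d)\<close> the same limit as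
  \<open>f r\<close>.\<close>

lemma filterlim_diff_rank:
  assumes "rank_function E \<rho>" "d \<in> hikes E"
  shows "filterlim (\<lambda>r. r - \<rho> d) (rank_at_top E \<rho>) (rank_at_top E \<rho>)"
  unfolding rank_at_top_def
proof (rule filterlim_inf[THEN iffD2], intro conjI)
  have "filterlim (\<lambda>r. r - \<rho> d) at_top at_top"
    using filterlim_tendsto_add_at_top[OF tendsto_const filterlim_ident, of "- \<rho> d"] by simp
  then show "filterlim (\<lambda>r. r - \<rho> d) at_top (inf at_top (principal (rank_group E \<rho>)))"
    by (rule filterlim_mono) auto
  show "filterlim (\<lambda>r. r - \<rho> d) (principal (rank_group E \<rho>))
      (inf at_top (principal (rank_group E \<rho>)))"
    using assms by (auto simp: filterlim_principal eventually_inf_principal diff_rank_in_rank_group)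
qed

section \<open>Real powers and the limit of the sieve\<close>

lemma real_power_nonzero: "real_power_defined a X \<Longrightarrow> real_power a x \<noteq> 0"
  by (auto simp: real_power_def real_power_defined_def)

lemma real_power_add:
  assumes "real_power_defined a X" "x \<in> X" "y \<in> X"
  shows "real_power a (x + y) = real_power a x * real_power a y"
proof (cases "a > 0")
  case True
  \<comment> \<open>For a positive base the integer branch of \<open>real_power\<close> agrees with
    \<open>powr\<close>.\<close>
  have "real_power a z = a powr z" for z
    using True by (auto simp: real_power_def powr_real_of_int' elim!: Ints_cases)
  then show ?thesis
    by (simp add: powr_add)
next
  case False
  then have "x \<in> \<int>" "y \<in> \<int>" "a \<noteq> 0"
    using assms by (auto simp: real_power_defined_def)
  then show ?thesis
    by (auto simp: real_power_def power_int_add elim!: Ints_cases simp flip: of_int_add)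
qed

text \<open>After division the factor \<open>real_power lam r\<close> cancels, and each divisor
  contributes its constant times \<open>f (r - \<rho> d) / f r\<close>, which tends to
  \<open>L / L = 1\<close>.\<close>

lemma sifted_ratio_tendsto:
  fixes A :: "real ^ 'v::finite ^ 'v"
  assumes rank: "rank_function E \<rho>" and "F \<subseteq> E"
    and summable: "\<And>r. hike_weight A summable_on hikes_of_rank E \<rho> r"
    and lam: "real_power_defined lam (rank_group E \<rho>)"
    and total: "\<And>r. r \<in> rank_group E \<rho> \<Longrightarrow>
      total_weight A (hikes_of_rank E \<rho> r) = real_power lam r * f r"
    and f: "(f \<longlongrightarrow> L) (rank_at_top E \<rho>)" and "L \<noteq> 0"
  shows "((\<lambda>r. total_weight A (sifted_hikes E \<rho> (primes F) r)
             / total_weight A (hikes_of_rank E \<rho> r)) \<longlongrightarrow>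
      (\<Sum>d\<in>self_avoiding_hikes F. mobius d * hike_weight A d * real_power lam (- \<rho> d)))
      (rank_at_top E \<rho>)"
proof -
  let ?D = "self_avoiding_hikes F" and ?c = "\<lambda>d. mobius d * hike_weight A d * real_power lam (- \<rho> d)"
  have D: "d \<in> hikes E" if "d \<in> ?D" for d
    using that hikes_mono[OF \<open>F \<subseteq> E\<close>] by (auto simp: self_avoiding_hikes_def)
  have "((\<lambda>r. \<Sum>d\<in>?D. ?c d * (f (r - \<rho> d) / f r)) \<longlongrightarrow> (\<Sum>d\<in>?D. ?c d * (L / L))) (rank_at_top E \<rho>)"
    using f \<open>L \<noteq> 0\<close>
    by (intro tendsto_sum tendsto_mult tendsto_const tendsto_divide
        filterlim_compose[OF f filterlim_diff_rank[OF rank]] D)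
  moreover have "eventually (\<lambda>r. (\<Sum>d\<in>?D. ?c d * (f (r - \<rho> d) / f r)) =
      total_weight A (sifted_hikes E \<rho> (primes F) r)
        / total_weight A (hikes_of_rank E \<rho> r)) (rank_at_top E \<rho>)"
  proof -
    have "(\<Sum>d\<in>?D. ?c d * (f (r - \<rho> d) / f r)) =
      total_weight A (sifted_hikes E \<rho> (primes F) r)
        / total_weight A (hikes_of_rank E \<rho> r)" if r: "r \<in> rank_group E \<rho>" for r
      unfolding total_weight_sifted_hikes[OF rank \<open>F \<subseteq> E\<close> summable] sum_divide_distrib
    proof (intro sum.cong refl)
      fix d assume "d \<in> ?D"
      note d = D[OF this]
      have "real_power lam (r - \<rho> d) = real_power lam r * real_power lam (- \<rho> d)"
        using real_power_add[OF lam r rank_in_rank_group(2)[OF rank d]] by simp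
      then show "?c d * (f (r - \<rho> d) / f r) =
          mobius d * hike_weight A d * total_weight A (hikes_of_rank E \<rho> (r - \<rho> d))
            / total_weight A (hikes_of_rank E \<rho> r)"
        \<comment> \<open>Only the power of \<open>lam\<close> has to be nonzero for cancelling:
          where \<open>f r = 0\<close>, both sides are 0 by the convention on division.\<close>
        using real_power_nonzero[OF lam]
        by (simp add: total r diff_rank_in_rank_group[OF rank r d])
    qed
    then show ?thesis
      by (auto simp: rank_at_top_def eventually_inf_principal)
  qed
  ultimately show ?thesis
    using \<open>L \<noteq> 0\<close> by (simp add: filterlim_cong[OF refl refl])
qed

text \<open>For a nonzero constant, convergence already implies asymptotic equivalence.\<close>

lemma asymp_constI: "(g \<longlongrightarrow> c) F \<Longrightarrow> asymp_const g c F"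
  by (auto simp: asymp_const_def intro: tendsto_imp_asymp_equiv_const)

section \<open>From weights to cardinalities\<close>

lemma hike_weight_unweighted:
  assumes "unweighted A" "h \<in> hikes (arcs A)"
  shows "hike_weight A h = 1"
proof -
  have "cycle_weight A c = 1" if "c \<in> primes (arcs A)" for c
    unfolding cycle_weight_def
    using that assms(1) by (intro prod.neutral) (fastforce simp: primes_def arcs_def unweighted_def)
  moreover obtain cs where "set cs \<subseteq> primes (arcs A)" "h = abs_hike cs"
    using assms(2) by (auto simp: hikes_def prod_list_prime_hike)
  ultimately show ?thesis
    by (induction cs arbitrary: h) (auto simp: hike_weight.abs_eq)
qed

lemma total_weight_unweighted:
  assumes "unweighted A" "X \<subseteq> hikes (arcs A)"
  shows "total_weight A X = real (card X)"
proof -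
  have "total_weight A X = infsum (\<lambda>_. 1) X"
    unfolding total_weight_def
    using assms by (intro infsum_cong hike_weight_unweighted) auto
  \<comment> \<open>This includes infinite \<open>X\<close>: the constant 1 is then not summable,
    and both \<open>infsum\<close> and \<open>card\<close> default to 0.\<close>
  then show ?thesis by simp
qed

text \<open>In a weighted graph the multiples of \<open>d\<close> carry an extra factor
  \<open>hike_weight A d\<close>, which therefore enters the sum. It equals 1 in an unweighted
  graph, where the second conclusion counts hikes.\<close>

theorem mainTheorem3:
  fixes A :: "real ^ 'v::finite ^ 'v" and U :: "'v set"
    and \<rho> :: "'v hike \<Rightarrow> real" and lam L :: real and f :: "real \<Rightarrow> real"
  defines "E \<equiv> arcs A"
  defines "EH \<equiv> induced_arcs E U"
  assumes "rank_function E \<rho>"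
    and "\<And>r. hike_weight A summable_on hikes_of_rank E \<rho> r"
    and "real_power_defined lam (rank_group E \<rho>)"
    and "\<And>r. r \<in> rank_group E \<rho> \<Longrightarrow>
           total_weight A (hikes_of_rank E \<rho> r) = real_power lam r * f r"
    and "bounded (f ` rank_group E \<rho>)"
    and "(f \<longlongrightarrow> L) (rank_at_top E \<rho>)"
    and "L \<noteq> 0"
  shows "asymp_const
           (\<lambda>r. total_weight A (sifted_hikes E \<rho> (primes EH) r)
                  / total_weight A (hikes_of_rank E \<rho> r))
           (\<Sum>d\<in>self_avoiding_hikes EH. mobius d * hike_weight A d * real_power lam (- \<rho> d))
           (rank_at_top E \<rho>)
       \<and> (unweighted A \<longrightarrow>
           asymp_const
             (\<lambda>r. real (card (sifted_hikes E \<rho> (primes EH) r))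
                    / real (card (hikes_of_rank E \<rho> r)))
             (\<Sum>d\<in>self_avoiding_hikes EH. mobius d * real_power lam (- \<rho> d))
             (rank_at_top E \<rho>))"
proof -
  have "EH \<subseteq> E"
    by (auto simp: EH_def induced_arcs_def)
  let ?P = "\<lambda>X Y Z. asymp_const (\<lambda>r. X r / Y r) (\<Sum>d\<in>self_avoiding_hikes EH. Z d) (rank_at_top E \<rho>)"
  have weighted: "?P (\<lambda>r. total_weight A (sifted_hikes E \<rho> (primes EH) r))
      (\<lambda>r. total_weight A (hikes_of_rank E \<rho> r))
      (\<lambda>d. mobius d * hike_weight A d * real_power lam (- \<rho> d))"
    by (rule asymp_constI, rule sifted_ratio_tendsto[where f = f and L = L])
      (fact assms \<open>EH \<subseteq> E\<close>)+
  moreover have "?P (\<lambda>r. real (card (sifted_hikes E \<rho> (primes EH) r)))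
      (\<lambda>r. real (card (hikes_of_rank E \<rho> r)))
      (\<lambda>d. mobius d * real_power lam (- \<rho> d))" if "unweighted A"
  proof -
    \<comment> \<open>The counting version is the weighted one rewritten: total weights become
      cardinalities and divisor weights become 1.\<close>
    have "total_weight A (hikes_of_rank E \<rho> r) = card (hikes_of_rank E \<rho> r)"
      "total_weight A (sifted_hikes E \<rho> (primes EH) r) = card (sifted_hikes E \<rho> (primes EH) r)" for r
      using that by (auto simp: E_def hikes_of_rank_def sifted_hikes_def intro!: total_weight_unweighted)
    moreover have "hike_weight A d = 1" if "d \<in> self_avoiding_hikes EH" for d
      using that \<open>unweighted A\<close> hikes_mono[OF \<open>EH \<subseteq> E\<close>]
      by (auto simp: E_def self_avoiding_hikes_def intro!: hike_weight_unweighted)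
    ultimately show ?thesis
      using weighted by (simp cong: sum.cong)
  qed
  ultimately show ?thesis
    by blast
qed

end
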